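(* Let $p$ be a prime with $p>48$, let $N$ be a multiple of $p^2$, and let $F:\mathbb{B}\to(\mathbb{Z}/p\mathbb{Z})^\times$ be an $\mathcal{S}_{p,N}$-Sudoku solution with non-constant columns. Then for every integer $r\ge0$ there exist integers $A,B,C$ with $p\nmid B$ such that $F(n,m)=f_p(An+Bm+C)$ whenever $(n,m)\in\mathbb{B}$ satisfies $\nu_p(An+Bm+C)\le r$.
   Context: $\pi_p:\mathbb{Z}\to\mathbb{Z}/p\mathbb{Z}$ is reduction mod $p$, $(\mathbb{Z}/p\mathbb{Z})^\times=(\mathbb{Z}/p\mathbb{Z})\setminus\{0\}$, $\nu_p$ is the $p$-adic valuation with $\nu_p(0)=+\infty$. Define $f_p(n)=\pi_p(n/p^{\nu_p(n)})$ for $n\ne0$ and $f_p(0)=1\bmod p$. The Sudoku board is $\mathbb{B}=\{0,\dots,N-1\}\times\mathbb{Z}$. The Sudoku rule $\mathcal{S}_{p,N}$ is the set of functions $g:\{0,\dots,N-1\}\to(\mathbb{Z}/p\mathbb{Z})^\times$ for which there exist integers $a,b$, not both divisible by $p$, such that $g(n)=f_p(an+b)$ for all $n\in\{0,\dots,N-1\}$ with $\nu_p(an+b)\le1$. An $\mathcal{S}_{p,N}$-Sudoku solution is $F:\mathbb{B}\to(\mathbb{Z}/p\mathbb{Z})^\times$ such that for all $j,i\in\mathbb{Z}$ the function $n\mapsto F(n,jn+i)$ lies in $\mathcal{S}_{p,N}$. $F$ has non-constant columns if for every $n\in\{0,\dots,N-1\}$, $m\mapsto F(n,m)$ is non-constant.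 *)

theory Defs
  imports "HOL-Number_Theory.Residues" "HOL-Library.Extended_Nat"
begin

text \<open>
  Elements of \<open>\<int>/p\<int>\<close> are represented by the carrier \<open>{0..p-1}\<close> of the library's ring
  \<^const>\<open>residue_ring\<close>, so reduction modulo \<open>p\<close> is \<open>\<lambda>n. n mod p\<close>.
\<close>

definition residue_units :: "nat \<Rightarrow> int set" where
  "residue_units p = carrier (residue_ring (int p)) - {0}"

text \<open>
  The library's \<^const>\<open>multiplicity\<close> takes the value \<open>0\<close> at \<open>0\<close>, whereas the valuation of \<open>0\<close>
  is infinite.
\<close>

definition padic_val :: "nat \<Rightarrow> int \<Rightarrow> enat" where
  "padic_val p n = (if n = 0 then \<infinity> else enat (multiplicity (int p) n))"

definition last_digit :: "nat \<Rightarrow> int \<Rightarrow> int" where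
  "last_digit p n =
     (if n = 0 then 1 mod int p
      else (n div int p ^ multiplicity (int p) n) mod int p)"

definition board :: "nat \<Rightarrow> (int \<times> int) set" where
  "board N = {0..<int N} \<times> UNIV"

text \<open>
  Functions on \<open>{0,\<dots>,N-1}\<close> and on the board are total HOL functions whose values off the
  domain are irrelevant.
\<close>

definition sudoku_rule :: "nat \<Rightarrow> nat \<Rightarrow> (int \<Rightarrow> int) set" where
  "sudoku_rule p N =
     {g \<in> {0..<int N} \<rightarrow> residue_units p.
        \<exists>a b. \<not> (int p dvd a \<and> int p dvd b) \<and>
          (\<forall>n\<in>{0..<int N}. padic_val p (a * n + b) \<le> 1 \<longrightarrow> g n = last_digit p (a * n + b))}"

definition sudoku_solution :: "nat \<Rightarrow> nat \<Rightarrow> (int \<times> int \<Rightarrow> int) \<Rightarrow> bool" where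
  "sudoku_solution p N F \<longleftrightarrow>
     F \<in> board N \<rightarrow> residue_units p \<and>
     (\<forall>j i. (\<lambda>n. F (n, j * n + i)) \<in> sudoku_rule p N)"

definition nonconstant_columns :: "nat \<Rightarrow> (int \<times> int \<Rightarrow> int) \<Rightarrow> bool" where
  "nonconstant_columns N F \<longleftrightarrow>
     (\<forall>n\<in>{0..<int N}. \<exists>m m'. F (n, m) \<noteq> F (n, m'))"

end

theory Submission
  imports Defs
begin

text \<open>
  On a non-vertical line, \<open>F\<close> is a nonzero affine function modulo \<open>p\<close> away from the zeros of
  that function. Apply this to a \<open>12 \<times> 12\<close> block cut out by lines of slopes \<open>0\<close> and \<open>1\<close>.
  Each line of slope \<open>1\<close> has at most one zero in the block, so two lines of slope \<open>0\<close> are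
  almost free of such zeros; interpolating between these two gives a bilinear form that must
  agree with \<open>F\<close> wherever it does not vanish. A line of slope \<open>-1\<close> kills the mixed term. The
  resulting affine form extends to the whole board along lines of slope \<open>0\<close> and \<open>\<plusminus>1\<close>, and
  non-constancy of the columns gives \<open>p \<nmid> B\<close>. This settles \<open>r = 0\<close>.

  For the induction on \<open>r\<close>, the points where the form \<open>An + Bm + C\<close> vanishes modulo \<open>p\<close> are
  \<open>m = \<sigma>n + \<tau> + pm'\<close>, and \<open>F'(n, m') = F(n, \<sigma>n + \<tau> + pm')\<close> is again a Sudoku solution. The rule
  at valuation \<open>1\<close> says that \<open>F'\<close> inherits the slope \<open>B\<close>; this makes the columns of \<open>F'\<close>
  non-constant and forces the form found for \<open>F'\<close> to have \<open>B' \<equiv> B\<close>, so that it can be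
  glued to the form of \<open>F\<close>.
\<close>

section \<open>Zeros of affine and quadratic polynomials modulo a prime\<close>

lemma dvd_iff_if_dvd_diff:
  fixes P :: int
  assumes "P dvd x - y"
  shows "P dvd x \<longleftrightarrow> P dvd y"
  using assms by (metis mod_eq_dvd_iff dvd_eq_mod_eq_0)

lemma two_zeros_affine:
  fixes P :: int
  assumes "prime P" "\<not> P dvd x - y" "P dvd a * x + b" "P dvd a * y + b"
  shows "P dvd a" "P dvd b"
proof -
  have "P dvd (a * x + b) - (a * y + b)" using assms by (intro dvd_diff)
  then have "P dvd a * (x - y)" by (simp add: algebra_simps)
  then show "P dvd a" using assms prime_dvd_mult_iff by blast
  then have "P dvd a * x" by simp
  then show "P dvd b" using assms(3) dvd_add_right_iff by blast
qed

lemma not_dvd_diff_interval: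
  fixes P :: int
  assumes "x \<in> {s..<s + P}" "y \<in> {s..<s + P}" "x \<noteq> y"
  shows "\<not> P dvd x - y"
proof
  assume "P dvd x - y"
  then have "\<bar>P\<bar> \<le> \<bar>x - y\<bar>" using assms(3) dvd_imp_le_int[of "x - y" P] by simp
  then show False using assms by auto
qed

lemma card_le_Suc_0_if_eq:
  assumes "\<And>x y. x \<in> A \<Longrightarrow> y \<in> A \<Longrightarrow> x = y"
  shows "card A \<le> Suc 0"
proof (cases "finite A")
  case True
  then show ?thesis using assms by (simp add: card_le_Suc0_iff_eq)
qed simp

text \<open>Distinct points of a window of length \<open>P\<close> are incongruent, so two zeros
  there would force both coefficients to vanish modulo \<open>P\<close>.\<close>

lemma card_zeros_affine:
  fixes P :: int
  assumes "prime P" "\<not> (P dvd a \<and> P dvd b)" "S \<subseteq> {s..<s + P}"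
  shows "card {x \<in> S. P dvd a * x + b} \<le> Suc 0"
proof (rule card_le_Suc_0_if_eq)
  fix x y assume *: "x \<in> {x \<in> S. P dvd a * x + b}" "y \<in> {x \<in> S. P dvd a * x + b}"
  show "x = y"
  proof (rule ccontr)
    assume "x \<noteq> y"
    then have "\<not> P dvd x - y" using * assms(3) by (intro not_dvd_diff_interval[of x s P y]) blast+
    then show False using two_zeros_affine[OF assms(1), of x y a b] * assms(2) by blast
  qed
qed

lemma finite_subset_interval:
  fixes S :: "int set"
  shows "S \<subseteq> {s..<t} \<Longrightarrow> finite S"
  using finite_subset by blast

lemma card_diff_zeros:
  assumes "finite S" "card {x \<in> S. Q x} \<le> m" "card S \<ge> n + m"
  shows "card {x \<in> S. \<not> Q x} \<ge> n"
proof -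
  have "card ({x \<in> S. Q x} \<union> {x \<in> S. \<not> Q x}) = card {x \<in> S. Q x} + card {x \<in> S. \<not> Q x}"
    by (rule card_Un_disjoint) (use assms(1) in auto)
  moreover have "{x \<in> S. Q x} \<union> {x \<in> S. \<not> Q x} = S" by auto
  ultimately show ?thesis using assms by simp
qed

lemma card_ge_2_distinct:
  assumes "card S \<ge> 2"
  obtains x y where "x \<in> S" "y \<in> S" "x \<noteq> y"
proof -
  obtain T where "T \<subseteq> S" "card T = 2" using obtain_subset_with_card_n[OF assms] by metis
  then show thesis using that by (auto simp: card_2_iff)
qed

lemma card_ge_3_distinct:
  assumes "card S \<ge> 3"
  obtains x y z where "x \<in> S" "y \<in> S" "z \<in> S" "x \<noteq> y" "y \<noteq> z" "x \<noteq> z"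
proof -
  obtain T where "T \<subseteq> S" "card T = 3" using obtain_subset_with_card_n[OF assms] by metis
  then show thesis using that by (auto simp: card_3_iff)
qed

text \<open>Each form has at most one zero in \<open>S\<close>, so two of the four points avoid the
  zeros of both. There both forms compute \<open>v\<close>, so their difference is an affine
  function with two incongruent zeros.\<close>

lemma affine_unique:
  fixes P :: int
  assumes P: "prime P" and S: "S \<subseteq> {s..<s + P}" "card S \<ge> 4"
    and ab: "\<not> (P dvd a \<and> P dvd b)" and cd: "\<not> (P dvd c \<and> P dvd d)"
    and v: "\<And>x. x \<in> S \<Longrightarrow> \<not> P dvd a * x + b \<Longrightarrow> v x = (a * x + b) mod P"
    and w: "\<And>x. x \<in> S \<Longrightarrow> \<not> P dvd c * x + d \<Longrightarrow> v x = (c * x + d) mod P"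
  shows "P dvd a - c" "P dvd b - d"
proof -
  let ?S1 = "{x \<in> S. \<not> P dvd a * x + b}"
  let ?S2 = "{x \<in> ?S1. \<not> P dvd c * x + d}"
  have fin: "finite S" using S finite_subset_interval by blast
  have "card ?S1 \<ge> 3"
    using card_diff_zeros[OF fin card_zeros_affine[OF P ab S(1)]] S(2) by simp
  moreover have "card {x \<in> ?S1. P dvd c * x + d} \<le> Suc 0"
    by (rule card_zeros_affine[OF P cd, where s = s]) (use S in auto)
  ultimately have "card ?S2 \<ge> 2"
    using card_diff_zeros[of ?S1 "\<lambda>x. P dvd c * x + d" 1 2] fin by simp
  then obtain x y where xy: "x \<in> ?S2" "y \<in> ?S2" "x \<noteq> y" by (rule card_ge_2_distinct)
  have z: "P dvd (a - c) * t + (b - d)" if "t \<in> ?S2" for t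
  proof -
    have "(a * t + b) mod P = (c * t + d) mod P" using v[of t] w[of t] that by simp
    then have "P dvd (a * t + b) - (c * t + d)" by (simp add: mod_eq_dvd_iff)
    then show ?thesis by (simp add: algebra_simps)
  qed
  have "\<not> P dvd x - y" using xy S(1) by (intro not_dvd_diff_interval[of x s P y]) blast+
  then show "P dvd a - c" "P dvd b - d"
    using two_zeros_affine[OF P _ z z] xy by blast+
qed

text \<open>Subtracting values and cancelling the difference of arguments shows that
  \<open>a * t + b\<close> vanishes at \<open>t = x + y\<close> and at \<open>t = x + z\<close>,
  which differ by \<open>y - z\<close>.\<close>

lemma three_zeros_quadratic:
  fixes P :: int
  assumes P: "prime P" and d: "\<not> P dvd x - y" "\<not> P dvd y - z" "\<not> P dvd x - z"
    and "P dvd a * x\<^sup>2 + b * x + c" "P dvd a * y\<^sup>2 + b * y + c" "P dvd a * z\<^sup>2 + b * z + c"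
  shows "P dvd a"
proof -
  have "P dvd (a * x\<^sup>2 + b * x + c) - (a * y\<^sup>2 + b * y + c)" using assms by (intro dvd_diff)
  then have "P dvd (x - y) * (a * (x + y) + b)" by (simp add: algebra_simps power2_eq_square)
  then have 1: "P dvd a * (x + y) + b" using P d prime_dvd_mult_iff by blast
  have "P dvd (a * x\<^sup>2 + b * x + c) - (a * z\<^sup>2 + b * z + c)" using assms by (intro dvd_diff)
  then have "P dvd (x - z) * (a * (x + z) + b)" by (simp add: algebra_simps power2_eq_square)
  then have 2: "P dvd a * (x + z) + b" using P d prime_dvd_mult_iff by blast
  show ?thesis by (rule two_zeros_affine[OF P _ 1 2]) (use d in simp)
qed

text \<open>If \<open>c\<close> were nonzero modulo \<open>P\<close>, discarding at most one zero of
  the affine form and at most two of the quadratic would leave three of the six points. There the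
  two agree, which gives a quadratic with leading coefficient \<open>c\<close> three zeros.\<close>

lemma quadratic_not_affine:
  fixes P :: int
  assumes P: "prime P" and S: "S \<subseteq> {s..<s + P}" "card S \<ge> 6"
    and ab: "\<not> (P dvd a \<and> P dvd b)"
    and v: "\<And>x. x \<in> S \<Longrightarrow> \<not> P dvd a * x + b \<Longrightarrow> v x = (a * x + b) mod P"
    and w: "\<And>x. x \<in> S \<Longrightarrow> \<not> P dvd c * x\<^sup>2 + d * x + e \<Longrightarrow> v x = (c * x\<^sup>2 + d * x + e) mod P"
  shows "P dvd c"
proof (rule ccontr)
  assume c: "\<not> P dvd c"
  \<comment> \<open>The lower coefficients stay free because this serves twice: for the quadratic
    itself and for its difference from the affine form.\<close>
  have few: "card U \<le> 2" if "U \<subseteq> S" "\<And>x. x \<in> U \<Longrightarrow> P dvd c * x\<^sup>2 + d' * x + e'" for U d' e'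
  proof (rule ccontr)
    assume "\<not> card U \<le> 2"
    then have "card U \<ge> 3" by simp
    then obtain x y z where xyz: "x \<in> U" "y \<in> U" "z \<in> U" "x \<noteq> y" "y \<noteq> z" "x \<noteq> z"
      by (rule card_ge_3_distinct)
    have "\<not> P dvd t - u" if "t \<in> U" "u \<in> U" "t \<noteq> u" for t u
      using that \<open>U \<subseteq> S\<close> S(1) not_dvd_diff_interval[of t s P u] by blast
    then have "P dvd c" using three_zeros_quadratic[OF P, of x y z c d' e'] that(2) xyz by blast
    then show False using c by simp
  qed
  let ?S1 = "{x \<in> S. \<not> P dvd a * x + b}"
  let ?S2 = "{x \<in> ?S1. \<not> P dvd c * x\<^sup>2 + d * x + e}"
  have fin: "finite S" using S finite_subset_interval by blast
  have "card ?S1 \<ge> 5"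
    using card_diff_zeros[OF fin card_zeros_affine[OF P ab S(1)]] S(2) by simp
  moreover have "card {x \<in> ?S1. P dvd c * x\<^sup>2 + d * x + e} \<le> 2" by (rule few) auto
  ultimately have "card ?S2 \<ge> 3"
    using card_diff_zeros[of ?S1 "\<lambda>x. P dvd c * x\<^sup>2 + d * x + e" 2 3] fin by simp
  moreover have "card ?S2 \<le> 2"
  proof (rule few)
    fix t assume t: "t \<in> ?S2"
    have "(c * t\<^sup>2 + d * t + e) mod P = (a * t + b) mod P" using v[of t] w[of t] t by simp
    then have "P dvd (c * t\<^sup>2 + d * t + e) - (a * t + b)" by (simp add: mod_eq_dvd_iff)
    then show "P dvd c * t\<^sup>2 + (d - a) * t + (e - b)" by (simp add: algebra_simps)
  qed auto
  ultimately show False by simp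
qed

section \<open>Bilinear forms on a 12 by 12 block\<close>

lemma prime_inverse_mod:
  fixes P :: int
  assumes "prime P" "\<not> P dvd x"
  obtains y where "P dvd x * y - 1"
proof -
  have "coprime x P" using assms by (simp add: prime_imp_coprime coprime_commute)
  then obtain y where "[x * y = 1] (mod P)" using cong_solve_coprime_int by blast
  then show thesis using that by (simp add: cong_iff_dvd_diff)
qed

text \<open>Linear interpolation in \<open>i\<close>, with the inverse \<open>e\<close> of
  \<open>i - i'\<close> in place of division: exact in row \<open>i\<close>, correct modulo
  \<open>P\<close> in row \<open>i'\<close>.\<close>

lemma bilinear_interpolation:
  fixes P :: int
  assumes "prime P" "\<not> P dvd i - i'"
  obtains \<beta> \<delta> \<alpha> \<gamma> where
    "\<And>k. P dvd (\<alpha> + \<beta> * i + \<gamma> * k + \<delta> * i * k) - (a * k + b)"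
    "\<And>k. P dvd (\<alpha> + \<beta> * i' + \<gamma> * k + \<delta> * i' * k) - (a' * k + b')"
proof -
  obtain e where e: "P dvd (i - i') * e - 1" using prime_inverse_mod assms by blast
  define \<beta> \<delta> \<alpha> \<gamma> where "\<beta> = e * (b - b')" "\<delta> = e * (a - a')"
    "\<alpha> = b - \<beta> * i" "\<gamma> = a - \<delta> * i"
  note defs = this
  have "(\<alpha> + \<beta> * i' + \<gamma> * k + \<delta> * i' * k) - (a' * k + b')
      = - ((i - i') * e - 1) * ((b - b') + (a - a') * k)" for k
    by (simp add: defs algebra_simps)
  then have "P dvd (\<alpha> + \<beta> * i' + \<gamma> * k + \<delta> * i' * k) - (a' * k + b')" for k
    using e by (metis dvd_mult2 dvd_minus_iff)
  moreover have "(\<alpha> + \<beta> * i + \<gamma> * k + \<delta> * i * k) - (a * k + b) = 0" for k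
    by (simp add: defs algebra_simps)
  ultimately show thesis using that[of \<alpha> \<beta> \<gamma> \<delta>] by simp
qed

text \<open>Double counting: the 12 columns contain at most 12 marked cells, so at most 6 rows
  contain two or more, and at least 6 rows remain.\<close>

lemma two_sparse_rows:
  assumes "\<And>k. k \<in> {0..<12::int} \<Longrightarrow> card {i \<in> {0..<12::int}. Z i k} \<le> Suc 0"
  obtains i i' where "i \<in> {0..<12}" "i' \<in> {0..<12}" "i \<noteq> i'"
    "card {k \<in> {0..<12::int}. Z i k} \<le> Suc 0" "card {k \<in> {0..<12::int}. Z i' k} \<le> Suc 0"
proof -
  let ?I = "{0..<12::int}"
  let ?c = "\<lambda>i. card {k \<in> ?I. Z i k}"
  let ?B = "{i \<in> ?I. \<not> ?c i \<le> Suc 0}"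
  have "2 * card ?B = (\<Sum>i\<in>?B. 2)" by simp
  also have "\<dots> \<le> (\<Sum>i\<in>?B. ?c i)" by (rule sum_mono) auto
  also have "\<dots> \<le> (\<Sum>i\<in>?I. ?c i)" by (rule sum_mono2) auto
  also have "\<dots> = (\<Sum>i\<in>?I. \<Sum>k\<in>?I. if Z i k then 1 else 0)"
    by (intro sum.cong refl) (simp add: sum.If_cases Int_def)
  also have "\<dots> = (\<Sum>k\<in>?I. \<Sum>i\<in>?I. if Z i k then 1 else 0)" by (rule sum.swap)
  also have "\<dots> = (\<Sum>k\<in>?I. card {i \<in> ?I. Z i k})"
    by (intro sum.cong refl) (simp add: sum.If_cases Int_def)
  also have "\<dots> \<le> (\<Sum>k\<in>?I. 1)" by (rule sum_mono) (use assms in auto)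
  finally have "card ?B \<le> 6" by simp
  then have "card {i \<in> ?I. ?c i \<le> Suc 0} \<ge> 6"
    using card_diff_zeros[of ?I "\<lambda>i. \<not> ?c i \<le> Suc 0" 6 6] by simp
  then obtain i i' where "i \<in> {i \<in> ?I. ?c i \<le> Suc 0}" "i' \<in> {i \<in> ?I. ?c i \<le> Suc 0}" "i \<noteq> i'"
    using card_ge_2_distinct[of "{i \<in> ?I. ?c i \<le> Suc 0}"] by auto
  then show thesis using that by blast
qed

text \<open>Two rows with few zeros of the column forms determine a bilinear candidate
  \<open>T\<close>. It is first compared with the column forms, on the columns where both rows carry
  usable values, and these columns are numerous enough to identify \<open>T\<close> with every row
  form on which it does not vanish.\<close>

lemma affine_rows_columns_imp_bilinear:
  fixes P :: int and M :: "int \<Rightarrow> int \<Rightarrow> int"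
  assumes P: "prime P" "12 \<le> P"
    and rows: "\<And>i. i \<in> {0..<12} \<Longrightarrow> \<exists>a b. \<not> (P dvd a \<and> P dvd b) \<and>
      (\<forall>k\<in>{0..<12}. \<not> P dvd a * k + b \<longrightarrow> M i k = (a * k + b) mod P)"
    and cols: "\<And>k. k \<in> {0..<12} \<Longrightarrow> \<exists>a b. \<not> (P dvd a \<and> P dvd b) \<and>
      (\<forall>i\<in>{0..<12}. \<not> P dvd a * i + b \<longrightarrow> M i k = (a * i + b) mod P)"
  obtains \<alpha> \<beta> \<gamma> \<delta> where "\<not> (P dvd \<alpha> \<and> P dvd \<beta> \<and> P dvd \<gamma> \<and> P dvd \<delta>)"
    "\<And>i k. i \<in> {0..<12} \<Longrightarrow> k \<in> {0..<12} \<Longrightarrow> \<not> P dvd \<alpha> + \<beta> * i + \<gamma> * k + \<delta> * i * k \<Longrightarrow>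
       M i k = (\<alpha> + \<beta> * i + \<gamma> * k + \<delta> * i * k) mod P"
proof -
  let ?I = "{0..<12::int}"
  have sub: "S \<subseteq> {0..<0 + P}" if "S \<subseteq> ?I" for S using that P(2) by auto
  have ndvd: "\<not> P dvd x - y" if "x \<in> ?I" "y \<in> ?I" "x \<noteq> y" for x y
    using that P(2) not_dvd_diff_interval[of x 0 P y] by auto
  obtain a b where ab: "\<And>i. i \<in> ?I \<Longrightarrow> \<not> (P dvd a i \<and> P dvd b i)"
    "\<And>i k. i \<in> ?I \<Longrightarrow> k \<in> ?I \<Longrightarrow> \<not> P dvd a i * k + b i \<Longrightarrow> M i k = (a i * k + b i) mod P"
    using rows by metis
  obtain c d where cd: "\<And>k. k \<in> ?I \<Longrightarrow> \<not> (P dvd c k \<and> P dvd d k)"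
    "\<And>i k. i \<in> ?I \<Longrightarrow> k \<in> ?I \<Longrightarrow> \<not> P dvd c k * i + d k \<Longrightarrow> M i k = (c k * i + d k) mod P"
    using cols by metis
  have "card {i \<in> ?I. P dvd c k * i + d k} \<le> Suc 0" if "k \<in> ?I" for k
    by (rule card_zeros_affine[OF P(1) cd(1)[OF that] sub]) simp
  then obtain i1 i2 where i12: "i1 \<in> ?I" "i2 \<in> ?I" "i1 \<noteq> i2"
    "card {k \<in> ?I. P dvd c k * i1 + d k} \<le> Suc 0" "card {k \<in> ?I. P dvd c k * i2 + d k} \<le> Suc 0"
    by (rule two_sparse_rows)
  obtain \<alpha> \<beta> \<gamma> \<delta> where
    T1: "\<And>k. P dvd (\<alpha> + \<beta> * i1 + \<gamma> * k + \<delta> * i1 * k) - (a i1 * k + b i1)" and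
    T2: "\<And>k. P dvd (\<alpha> + \<beta> * i2 + \<gamma> * k + \<delta> * i2 * k) - (a i2 * k + b i2)"
    using bilinear_interpolation[OF P(1) ndvd[OF i12(1-3)], of "a i1" "b i1" "a i2" "b i2"]
    by metis
  define T where "T i k = \<alpha> + \<beta> * i + \<gamma> * k + \<delta> * i * k" for i k
  \<comment> \<open>Good columns: in both chosen rows neither the row form nor the column form
    vanishes. Each of the four conditions excludes at most one column.\<close>
  define G where "G = {k \<in> ?I. \<not> P dvd a i1 * k + b i1 \<and> \<not> P dvd a i2 * k + b i2 \<and>
    \<not> P dvd c k * i1 + d k \<and> \<not> P dvd c k * i2 + d k}"
  let ?Z = "\<lambda>f. {k \<in> ?I. P dvd f k}"
  have finZ: "finite (?Z f)" for f :: "int \<Rightarrow> int" by (rule finite_subset[of _ ?I]) auto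
  have "card (?I - G) \<le> card (?Z (\<lambda>k. a i1 * k + b i1) \<union> ?Z (\<lambda>k. a i2 * k + b i2) \<union>
      (?Z (\<lambda>k. c k * i1 + d k) \<union> ?Z (\<lambda>k. c k * i2 + d k)))"
  proof (rule card_mono)
    show "?I - G \<subseteq> ?Z (\<lambda>k. a i1 * k + b i1) \<union> ?Z (\<lambda>k. a i2 * k + b i2) \<union>
      (?Z (\<lambda>k. c k * i1 + d k) \<union> ?Z (\<lambda>k. c k * i2 + d k))"
      unfolding G_def by blast
  qed (intro finite_UnI finZ)
  also have "\<dots> \<le> (card (?Z (\<lambda>k. a i1 * k + b i1)) + card (?Z (\<lambda>k. a i2 * k + b i2))) +
      (card (?Z (\<lambda>k. c k * i1 + d k)) + card (?Z (\<lambda>k. c k * i2 + d k)))"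
    by (intro order.trans[OF card_Un_le] add_mono card_Un_le)
  also have "\<dots> \<le> (Suc 0 + Suc 0) + (Suc 0 + Suc 0)"
    by (intro add_mono i12 card_zeros_affine[OF P(1) ab(1) sub]) simp_all
  finally have "card (?I - G) \<le> 4" by simp
  moreover have "G \<subseteq> ?I" by (auto simp: G_def)
  ultimately have cardG: "card G \<ge> 4" by (simp add: card_Diff_subset finite_subset)
  \<comment> \<open>On a good column, \<open>T\<close> and the column form are both affine in
    \<open>i\<close> and agree in rows \<open>i1\<close> and \<open>i2\<close>, hence in every
    row.\<close>
  have colsG: "P dvd T i k - (c k * i + d k)" if "k \<in> G" for i k
  proof -
    have k: "k \<in> ?I" using that by (simp add: G_def)
    have "P dvd (\<beta> + \<delta> * k - c k) * i' + (\<alpha> + \<gamma> * k - d k)"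
      if "i' \<in> ?I" "P dvd T i' k - (a i' * k + b i')" "\<not> P dvd a i' * k + b i'" 
        "\<not> P dvd c k * i' + d k" for i'
    proof -
      have "(a i' * k + b i') mod P = (c k * i' + d k) mod P"
        using ab(2)[of i' k] cd(2)[of i' k] that k by simp
      then have "P dvd (a i' * k + b i') - (c k * i' + d k)" by (simp add: mod_eq_dvd_iff)
      then have "P dvd T i' k - (a i' * k + b i') + ((a i' * k + b i') - (c k * i' + d k))"
        using that by (intro dvd_add)
      then show ?thesis by (simp add: T_def algebra_simps)
    qed
    then have "P dvd \<beta> + \<delta> * k - c k" "P dvd \<alpha> + \<gamma> * k - d k"
      using two_zeros_affine[OF P(1) ndvd[OF i12(1-3)], of "\<beta> + \<delta> * k - c k" "\<alpha> + \<gamma> * k - d k"]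
        T1 T2 \<open>k \<in> G\<close> i12 by (auto simp: G_def T_def)
    then have "P dvd (\<beta> + \<delta> * k - c k) * i + (\<alpha> + \<gamma> * k - d k)" by simp
    then show ?thesis by (simp add: T_def algebra_simps)
  qed
  have MG: "M i k = T i k mod P" if "i \<in> ?I" "k \<in> G" "\<not> P dvd T i k" for i k
  proof -
    have "\<not> P dvd c k * i + d k"
      using dvd_iff_if_dvd_diff[OF colsG[OF that(2), of i]] that(3) by simp
    moreover have "T i k mod P = (c k * i + d k) mod P"
      using colsG[OF that(2)] by (simp add: mod_eq_dvd_iff)
    ultimately show ?thesis using cd(2) that \<open>G \<subseteq> ?I\<close> by auto
  qed
  have T_row: "T i k = (\<gamma> + \<delta> * i) * k + (\<alpha> + \<beta> * i)" for i k by (simp add: T_def algebra_simps)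
  \<comment> \<open>Row \<open>i\<close> now matches \<open>T\<close> on the columns of
    \<open>G\<close>, at least four of them, so its row form is congruent to that of
    \<open>T\<close>; this carries the formula to the remaining columns.\<close>
  have M: "M i k = T i k mod P" if i: "i \<in> ?I" and k: "k \<in> ?I" and "\<not> P dvd T i k" for i k
  proof -
    have nz: "\<not> (P dvd \<gamma> + \<delta> * i \<and> P dvd \<alpha> + \<beta> * i)"
      using \<open>\<not> P dvd T i k\<close> unfolding T_row by auto
    have "P dvd a i - (\<gamma> + \<delta> * i)" "P dvd b i - (\<alpha> + \<beta> * i)"
      using affine_unique[OF P(1) sub cardG ab(1)[OF i] nz, of "M i"] \<open>G \<subseteq> ?I\<close> ab(2) MG i
      unfolding T_row by blast+
    then have "P dvd (a i - (\<gamma> + \<delta> * i)) * k + (b i - (\<alpha> + \<beta> * i))" by simp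
    then have *: "P dvd (a i * k + b i) - T i k" by (simp add: T_row algebra_simps)
    then have "\<not> P dvd a i * k + b i" using \<open>\<not> P dvd T i k\<close> dvd_iff_if_dvd_diff by blast
    then show ?thesis using ab(2)[OF i k] * by (simp add: mod_eq_dvd_iff)
  qed
  \<comment> \<open>Nontriviality: at a good column \<open>T\<close> is congruent in row
    \<open>i1\<close> to a nonzero row value.\<close>
  obtain k where k: "k \<in> G" using cardG by fastforce
  have "\<not> P dvd T i1 k" using dvd_iff_if_dvd_diff[OF T1[of k]] k by (simp add: T_def G_def)
  then have "\<not> (P dvd \<alpha> \<and> P dvd \<beta> \<and> P dvd \<gamma> \<and> P dvd \<delta>)" by (auto simp: T_def)
  then show thesis using that M unfolding T_def by blast
qed

section \<open>From affine lines to one affine form on the whole board\<close>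

text \<open>This is the valuation-zero part of the Sudoku rule. The bound 23 makes room for all
  columns \<open>i + k\<close> with \<open>i\<close> and \<open>k\<close> at most 11, and
  \<open>12 \<le> p\<close> keeps distinct block indices incongruent.\<close>

locale affine_lines =
  fixes p N :: int and F :: "int \<times> int \<Rightarrow> int"
  assumes prime_p: "prime p" and p_ge: "12 \<le> p" and N_ge: "23 \<le> N"
    and lines: "\<exists>a b. \<not> (p dvd a \<and> p dvd b) \<and>
      (\<forall>n\<in>{0..<N}. \<not> p dvd a * n + b \<longrightarrow> F (n, j * n + i) = (a * n + b) mod p)"
begin

definition agrees :: "int \<Rightarrow> int \<Rightarrow> int \<Rightarrow> int \<Rightarrow> int \<Rightarrow> bool" where
  "agrees A B C n m \<longleftrightarrow>
     (\<not> p dvd A * n + B * m + C \<longrightarrow> F (n, m) = (A * n + B * m + C) mod p)"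

text \<open>The board form restricts to an affine form on the line. If the restriction vanishes
  identically modulo \<open>p\<close> there is nothing to show; otherwise four points identify it
  with the line's own form by \<open>affine_unique\<close>.\<close>

lemma agrees_line:
  assumes S: "S \<subseteq> {s..<s + p}" "S \<subseteq> {0..<N}" "card S \<ge> 4"
    and agr: "\<And>x. x \<in> S \<Longrightarrow> agrees A B C x (j * x + i)"
    and n: "n \<in> {0..<N}"
  shows "agrees A B C n (j * n + i)"
  unfolding agrees_def
proof
  have eq: "A * x + B * (j * x + i) + C = (A + B * j) * x + (B * i + C)" for x
    by (simp add: algebra_simps)
  assume nz: "\<not> p dvd A * n + B * (j * n + i) + C"
  then have cd: "\<not> (p dvd A + B * j \<and> p dvd B * i + C)" unfolding eq by auto
  obtain a b where ab: "\<not> (p dvd a \<and> p dvd b)"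
    "\<And>x. x \<in> {0..<N} \<Longrightarrow> \<not> p dvd a * x + b \<Longrightarrow> F (x, j * x + i) = (a * x + b) mod p"
    using lines[of j i] by blast
  have "p dvd a - (A + B * j)" "p dvd b - (B * i + C)"
    using affine_unique[OF prime_p S(1,3) ab(1) cd, of "\<lambda>x. F (x, j * x + i)"] ab(2) agr S(2)
    unfolding agrees_def eq by blast+
  then have "p dvd (a - (A + B * j)) * n + (b - (B * i + C))" by simp
  then have *: "p dvd (a * n + b) - (A * n + B * (j * n + i) + C)" by (simp add: algebra_simps)
  then have "\<not> p dvd a * n + b" using nz dvd_iff_if_dvd_diff by blast
  then show "F (n, j * n + i) = (A * n + B * (j * n + i) + C) mod p"
    using ab(2)[OF n] * by (simp add: mod_eq_dvd_iff)
qed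

text \<open>In the coordinates \<open>(i + k, i)\<close>, fixing \<open>i\<close> gives a line of
  slope 0 and fixing \<open>k\<close> a line of slope 1, so \<open>F\<close> is bilinear on the
  block. It remains to remove the coefficient \<open>\<delta>\<close>.\<close>

lemma affine_on_block:
  obtains A B C where "\<not> (p dvd A \<and> p dvd B \<and> p dvd C)"
    "\<And>i k. i \<in> {0..<12} \<Longrightarrow> k \<in> {0..<12} \<Longrightarrow> agrees A B C (i + k) i"
proof -
  let ?I = "{0..<12::int}"
  have inN: "i + k \<in> {0..<N}" if "i \<in> ?I" "k \<in> ?I" for i k using that N_ge by auto
  have rows: "\<exists>a b. \<not> (p dvd a \<and> p dvd b) \<and>
      (\<forall>k\<in>?I. \<not> p dvd a * k + b \<longrightarrow> F (i + k, i) = (a * k + b) mod p)" if i: "i \<in> ?I" for i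
  proof -
    obtain a b where ab: "\<not> (p dvd a \<and> p dvd b)"
      "\<And>x. x \<in> {0..<N} \<Longrightarrow> \<not> p dvd a * x + b \<Longrightarrow> F (x, i) = (a * x + b) mod p"
      using lines[of 0 i] by (metis mult_zero_left add_0)
    have "\<not> (p dvd a \<and> p dvd a * i + b)" using ab(1) by (auto simp: dvd_add_right_iff)
    moreover have "F (i + k, i) = (a * k + (a * i + b)) mod p"
      if "k \<in> ?I" "\<not> p dvd a * k + (a * i + b)" for k
    proof -
      have "a * (i + k) + b = a * k + (a * i + b)" by (simp add: algebra_simps)
      then show ?thesis using ab(2)[OF inN[OF i that(1)]] that(2) by metis
    qed
    ultimately show ?thesis by blast
  qed
  have cols: "\<exists>a b. \<not> (p dvd a \<and> p dvd b) \<and>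
      (\<forall>i\<in>?I. \<not> p dvd a * i + b \<longrightarrow> F (i + k, i) = (a * i + b) mod p)" if k: "k \<in> ?I" for k
  proof -
    obtain a b where ab: "\<not> (p dvd a \<and> p dvd b)"
      "\<And>x. x \<in> {0..<N} \<Longrightarrow> \<not> p dvd a * x + b \<Longrightarrow> F (x, x - k) = (a * x + b) mod p"
      using lines[of 1 "- k"] by (metis mult_1 diff_conv_add_uminus)
    have "\<not> (p dvd a \<and> p dvd a * k + b)" using ab(1) by (auto simp: dvd_add_right_iff)
    moreover have "F (i + k, i) = (a * i + (a * k + b)) mod p"
      if "i \<in> ?I" "\<not> p dvd a * i + (a * k + b)" for i
    proof -
      have "a * (i + k) + b = a * i + (a * k + b)" by (simp add: algebra_simps)
      then show ?thesis using ab(2)[OF inN[OF that(1) k]] that(2) by (metis add_diff_cancel_right')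
    qed
    ultimately show ?thesis by blast
  qed
  obtain \<alpha> \<beta> \<gamma> \<delta> where T: "\<not> (p dvd \<alpha> \<and> p dvd \<beta> \<and> p dvd \<gamma> \<and> p dvd \<delta>)"
    "\<And>i k. i \<in> ?I \<Longrightarrow> k \<in> ?I \<Longrightarrow> \<not> p dvd \<alpha> + \<beta> * i + \<gamma> * k + \<delta> * i * k \<Longrightarrow>
       F (i + k, i) = (\<alpha> + \<beta> * i + \<gamma> * k + \<delta> * i * k) mod p"
    using affine_rows_columns_imp_bilinear[of p "\<lambda>i k. F (i + k, i)", OF prime_p p_ge rows cols]
    by (metis (no_types, lifting))
  \<comment> \<open>The line \<open>m = 10 - x\<close> meets the block where
    \<open>k = 10 - 2 * i\<close>, that is for \<open>i\<close> from 0 to 5: just the six points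
    that \<open>quadratic_not_affine\<close> requires. Along it the bilinear form has leading
    coefficient \<open>- 2 * \<delta>\<close>.\<close>
  obtain a b where ab: "\<not> (p dvd a \<and> p dvd b)"
    "\<And>x. x \<in> {0..<N} \<Longrightarrow> \<not> p dvd a * x + b \<Longrightarrow> F (x, 10 - x) = (a * x + b) mod p"
    using lines[of "- 1" 10] by (metis mult_minus1 uminus_add_conv_diff)
  have "p dvd - 2 * \<delta>"
  proof (rule quadratic_not_affine[OF prime_p, of "{0..<6}" 0 "- a" "10 * a + b" "\<lambda>i. F (10 - i, i)"])
    show "\<not> (p dvd - a \<and> p dvd 10 * a + b)" using ab(1) by (auto simp: dvd_add_right_iff)
  next
    fix i :: int assume i: "i \<in> {0..<6}" and nz: "\<not> p dvd - a * i + (10 * a + b)"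
    have "a * (10 - i) + b = - a * i + (10 * a + b)" by (simp add: algebra_simps)
    then show "F (10 - i, i) = (- a * i + (10 * a + b)) mod p"
      using ab(2)[of "10 - i"] i nz N_ge
      by (simp add: algebra_simps)
  next
    fix i :: int
    assume i: "i \<in> {0..<6}"
      and nz: "\<not> p dvd - 2 * \<delta> * i\<^sup>2 + (\<beta> - 2 * \<gamma> + 10 * \<delta>) * i + (\<alpha> + 10 * \<gamma>)"
    have "\<alpha> + \<beta> * i + \<gamma> * (10 - 2 * i) + \<delta> * i * (10 - 2 * i)
        = - 2 * \<delta> * i\<^sup>2 + (\<beta> - 2 * \<gamma> + 10 * \<delta>) * i + (\<alpha> + 10 * \<gamma>)"
      by (simp add: algebra_simps power2_eq_square)
    note eq = this
    have sum_eq: "i + (10 - 2 * i) = 10 - i" by simp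
    show "F (10 - i, i) =
        (- 2 * \<delta> * i\<^sup>2 + (\<beta> - 2 * \<gamma> + 10 * \<delta>) * i + (\<alpha> + 10 * \<gamma>)) mod p"
      by (rule T(2)[of i "10 - 2 * i", unfolded eq sum_eq, OF _ _ nz]) (use i in auto)
  qed (use p_ge in auto)
  moreover have "\<not> p dvd - 2" using p_ge zdvd_not_zless[of 2 p] by auto
  ultimately have \<delta>: "p dvd \<delta>" using prime_p prime_dvd_mult_iff by blast
  \<comment> \<open>Back in board coordinates \<open>n = i + k\<close>, \<open>m = i\<close>, the
    form \<open>\<alpha> + \<beta> * i + \<gamma> * k\<close> has these coefficients.\<close>
  have "agrees \<gamma> (\<beta> - \<gamma>) \<alpha> (i + k) i" if ik: "i \<in> ?I" "k \<in> ?I" for i k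
    unfolding agrees_def
  proof
    let ?A = "\<gamma> * (i + k) + (\<beta> - \<gamma>) * i + \<alpha>"
    let ?T = "\<alpha> + \<beta> * i + \<gamma> * k + \<delta> * i * k"
    assume nz: "\<not> p dvd ?A"
    have "?T - ?A = \<delta> * (i * k)" by (simp add: algebra_simps)
    then have *: "p dvd ?T - ?A" using \<delta> by (metis dvd_mult2)
    then have "\<not> p dvd ?T" using nz dvd_iff_if_dvd_diff by blast
    then show "F (i + k, i) = ?A mod p" using T(2)[OF ik] * by (simp add: mod_eq_dvd_iff)
  qed
  moreover have "\<not> (p dvd \<gamma> \<and> p dvd \<beta> - \<gamma> \<and> p dvd \<alpha>)"
    using T(1) \<delta> dvd_iff_if_dvd_diff by blast
  ultimately show thesis using that by blast
qed

text \<open>Four consecutive rows on one side of row \<open>m\<close> suffice: a diagonal through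
  \<open>(n, m)\<close> meets them in four consecutive columns, to the left of \<open>n\<close> if
  \<open>n \<ge> 4\<close> and to the right otherwise.\<close>

lemma agrees_propagate:
  assumes e: "e = 1 \<or> e = - 1"
    and agr: "\<And>t x. t \<in> {1..4} \<Longrightarrow> x \<in> {0..<N} \<Longrightarrow> agrees A B C x (m + e * t)"
    and n: "n \<in> {0..<N}"
  shows "agrees A B C n m"
proof (cases "n \<ge> 4")
  case True
  have "agrees A B C n (- e * n + (m + e * n))"
  proof (rule agrees_line[of "{n - 4..<n}" "n - 4"])
    fix x assume "x \<in> {n - 4..<n}"
    then have "agrees A B C x (m + e * (n - x))" using True n by (intro agr) auto
    then show "agrees A B C x (- e * x + (m + e * n))" by (simp add: algebra_simps)
  qed (use True n p_ge in auto)
  then show ?thesis by simp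
next
  case False
  have "agrees A B C n (e * n + (m - e * n))"
  proof (rule agrees_line[of "{n + 1..<n + 5}" "n + 1"])
    fix x assume "x \<in> {n + 1..<n + 5}"
    then have "agrees A B C x (m + e * (x - n))" using False n N_ge by (intro agr) auto
    then show "agrees A B C x (e * x + (m - e * n))" by (simp add: algebra_simps)
  qed (use False n p_ge N_ge in auto)
  then show ?thesis by simp
qed

lemma affine_on_board:
  obtains A B C where "\<not> (p dvd A \<and> p dvd B \<and> p dvd C)"
    "\<And>n m. n \<in> {0..<N} \<Longrightarrow> agrees A B C n m"
proof -
  obtain A B C where ABC: "\<not> (p dvd A \<and> p dvd B \<and> p dvd C)"
    "\<And>i k. i \<in> {0..<12} \<Longrightarrow> k \<in> {0..<12} \<Longrightarrow> agrees A B C (i + k) i"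
    using affine_on_block by metis
  \<comment> \<open>A window of four full rows. The first one comes from the block by horizontal
    lines, since row \<open>m\<close> of the block has 12 points; it then slides up and down one row
    at a time.\<close>
  define W where "W m \<longleftrightarrow> (\<forall>t\<in>{0..<4}. \<forall>n\<in>{0..<N}. agrees A B C n (m + t))" for m
  have "agrees A B C n m" if "m \<in> {0..<4}" "n \<in> {0..<N}" for n m
  proof -
    have "agrees A B C n (0 * n + m)"
    proof (rule agrees_line[of "{m..<m + 12}" m])
      fix x assume "x \<in> {m..<m + 12}"
      then show "agrees A B C x (0 * x + m)" using ABC(2)[of m "x - m"] that by simp
    qed (use that p_ge N_ge in auto)
    then show ?thesis by simp
  qed
  then have "W 0" unfolding W_def by simp
  have step_up: "W (m + 1)" if "W m" for m
  proof -
    have "agrees A B C n (m + 4)" if "n \<in> {0..<N}" for n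
    proof (rule agrees_propagate[where e = "- 1"])
      fix t x :: int assume "t \<in> {1..4}" "x \<in> {0..<N}"
      then have "agrees A B C x (m + (4 - t))" using \<open>W m\<close> by (auto simp: W_def)
      then show "agrees A B C x (m + 4 + - 1 * t)" by (simp add: algebra_simps)
    qed (use that in auto)
    moreover have "{0..<4::int} = {0, 1, 2, 3}" by auto
    ultimately show ?thesis using \<open>W m\<close> by (simp add: W_def add.assoc)
  qed
  have step_down: "W (m - 1)" if "W m" for m
  proof -
    have "agrees A B C n (m - 1)" if "n \<in> {0..<N}" for n
    proof (rule agrees_propagate[where e = 1])
      fix t x :: int assume "t \<in> {1..4}" "x \<in> {0..<N}"
      then have "agrees A B C x (m + (t - 1))" using \<open>W m\<close> by (auto simp: W_def)
      then show "agrees A B C x (m - 1 + 1 * t)" by (simp add: algebra_simps)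
    qed (use that in auto)
    moreover have "{0..<4::int} = {0, 1, 2, 3}" by auto
    ultimately show ?thesis using \<open>W m\<close> by (simp add: W_def algebra_simps)
  qed
  have "W m" for m
    by (induction m rule: int_induct[of _ 0]) (use \<open>W 0\<close> step_up step_down in auto)
  then have "agrees A B C n m" if "n \<in> {0..<N}" for n m
    using that unfolding W_def by (metis add.right_neutral atLeastLessThan_iff order_refl zero_less_numeral)
  then show thesis using that ABC(1) by blast
qed

text \<open>If \<open>p\<close> divided \<open>B\<close>, the form would depend only on the column
  modulo \<open>p\<close>. It would be nonzero in column 0 or column 1, making that column
  constant.\<close>

lemma nonconstant_imp_slope:
  assumes nonconst: "\<And>n. n \<in> {0..<N} \<Longrightarrow> \<exists>m m'. F (n, m) \<noteq> F (n, m')"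
  obtains A B C where "\<not> p dvd B" "\<And>n m. n \<in> {0..<N} \<Longrightarrow> agrees A B C n m"
proof -
  obtain A B C where ABC: "\<not> (p dvd A \<and> p dvd B \<and> p dvd C)"
    "\<And>n m. n \<in> {0..<N} \<Longrightarrow> agrees A B C n m"
    using affine_on_board by metis
  have "\<not> p dvd B"
  proof
    assume B: "p dvd B"
    obtain n where n: "n \<in> {0..<N}" "\<not> p dvd A * n + C"
    proof (cases "p dvd C")
      case True
      then have "\<not> p dvd A * 1 + C" using ABC(1) B by (simp add: dvd_add_left_iff)
      then show thesis using that[of 1] N_ge by simp
    next
      case False
      then show thesis using that[of 0] N_ge by simp
    qed
    have "F (n, m) = (A * n + C) mod p" for m
    proof -
      have *: "p dvd (A * n + B * m + C) - (A * n + C)" using B by simp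
      then have "\<not> p dvd A * n + B * m + C" using n dvd_iff_if_dvd_diff by blast
      then show ?thesis using ABC(2)[OF n(1), of m] * unfolding agrees_def
        by (simp add: mod_eq_dvd_iff)
    qed
    then show False using nonconst[OF n(1)] by simp
  qed
  then show thesis using that ABC(2) by blast
qed

end

section \<open>Last digits, valuations and the lines of a Sudoku solution\<close>

lemma last_digit_not_dvd: "\<not> int p dvd x \<Longrightarrow> last_digit p x = x mod int p"
  by (auto simp: last_digit_def not_dvd_imp_multiplicity_0)

lemma padic_val_not_dvd: "\<not> int p dvd x \<Longrightarrow> padic_val p x = 0"
  by (auto simp: padic_val_def not_dvd_imp_multiplicity_0 zero_enat_def)

lemma multiplicity_mult_prime:
  assumes "prime p" "x \<noteq> 0"
  shows "multiplicity (int p) (int p * x) = Suc (multiplicity (int p) x)"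
  using assms by (intro multiplicity_times_same) (auto simp: prime_gt_1_nat)

text \<open>This includes \<open>x = 0\<close>, where both sides are the default value.\<close>

lemma last_digit_mult:
  assumes "prime p"
  shows "last_digit p (int p * x) = last_digit p x"
  using assms by (simp add: last_digit_def multiplicity_mult_prime prime_gt_0_nat)

lemma padic_val_mult:
  assumes "prime p"
  shows "padic_val p (int p * x) = eSuc (padic_val p x)"
  using assms by (simp add: padic_val_def multiplicity_mult_prime prime_gt_0_nat eSuc_enat)

lemma sudoku_line:
  assumes "sudoku_solution p N F"
  obtains a b where "\<not> (int p dvd a \<and> int p dvd b)"
    "\<And>n. n \<in> {0..<int N} \<Longrightarrow> padic_val p (a * n + b) \<le> 1 \<Longrightarrow>
       F (n, j * n + i) = last_digit p (a * n + b)"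
proof -
  have "(\<lambda>n. F (n, j * n + i)) \<in> sudoku_rule p N"
    using assms by (simp add: sudoku_solution_def)
  then obtain a b where "\<not> (int p dvd a \<and> int p dvd b)"
    "\<forall>n\<in>{0..<int N}. padic_val p (a * n + b) \<le> 1 \<longrightarrow> F (n, j * n + i) = last_digit p (a * n + b)"
    unfolding sudoku_rule_def by blast
  then show thesis using that by blast
qed

lemma sudoku_affine_lines:
  assumes "prime p" "p > 48" "p\<^sup>2 \<le> N" "sudoku_solution p N F"
  shows "affine_lines (int p) (int N) F"
proof
  have "p \<le> p * p" by simp
  then have "23 \<le> N" using assms(2,3) unfolding power2_eq_square by linarith
  then show "23 \<le> int N" by simp
  fix j i
  obtain a b where ab: "\<not> (int p dvd a \<and> int p dvd b)"
    "\<And>n. n \<in> {0..<int N} \<Longrightarrow> padic_val p (a * n + b) \<le> 1 \<Longrightarrow>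
       F (n, j * n + i) = last_digit p (a * n + b)"
    using sudoku_line[OF assms(4)] by blast
  have "F (n, j * n + i) = (a * n + b) mod int p"
    if "n \<in> {0..<int N}" "\<not> int p dvd a * n + b" for n
    using ab(2)[OF that(1)] that(2) by (simp add: last_digit_not_dvd padic_val_not_dvd)
  then show "\<exists>a b. \<not> (int p dvd a \<and> int p dvd b) \<and>
      (\<forall>n\<in>{0..<int N}. \<not> int p dvd a * n + b \<longrightarrow> F (n, j * n + i) = (a * n + b) mod int p)"
    using ab(1) by blast
qed (use assms in auto)

lemma sudoku_values:
  assumes "sudoku_solution p N F" "n \<in> {0..<int N}"
  shows "F (n, m) \<in> residue_units p"
  using assms by (auto simp: sudoku_solution_def board_def Pi_iff)

lemma residue_units_not_dvd: "x \<in> residue_units p \<Longrightarrow> \<not> int p dvd x"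
  using zdvd_not_zless[of x "int p"] by (auto simp: residue_units_def residue_ring_def)

section \<open>Restriction to the points where the form vanishes modulo \<open>p\<close>\<close>

text \<open>The rule at valuation 1 enters here. A line of slope \<open>\<sigma> + j\<close> meets
  the zero set of the form in the columns \<open>n0 + P * k\<close>; there its own form is
  \<open>P\<close> times an affine function of \<open>k\<close>, whose slope is \<open>B * j\<close>
  modulo \<open>P\<close> and which gives the value of \<open>F\<close> where it is nonzero.\<close>

lemma sublattice_lines:
  fixes p N :: nat
  defines "P \<equiv> int p"
  assumes p: "prime p" "p > 48" "p\<^sup>2 \<le> N" and sol: "sudoku_solution p N F"
    and agr: "\<And>n m. n \<in> {0..<int N} \<Longrightarrow> \<not> P dvd A * n + B * m + C \<Longrightarrow>
      F (n, m) = (A * n + B * m + C) mod P"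
    and B: "\<not> P dvd B" and st: "P dvd A + B * \<sigma>" "P dvd C + B * \<tau>"
    and n0: "n0 \<in> {0..<P}" and j: "\<not> P dvd j"
  obtains b where "\<And>k. n0 + P * k \<in> {0..<int N} \<Longrightarrow> \<not> P dvd B * j * k + b \<Longrightarrow>
    F (n0 + P * k, \<sigma> * (n0 + P * k) + \<tau> + P * (j * k + i)) = (B * j * k + b) mod P"
proof -
  \<comment> \<open>Chosen so that the line with slope \<open>\<sigma> + j\<close> and intercept
    \<open>\<tau> + i0\<close> passes through the required points in the columns
    \<open>n0 + P * k\<close>.\<close>
  define i0 where "i0 = P * i - j * n0"
  have P: "prime P" "P \<ge> 49" using p by (auto simp: P_def)
  have "P * 1 \<le> P * P" by (rule mult_left_mono) (use P in auto)
  also have "P * P \<le> int N" using p(3) by (simp add: P_def power2_eq_square flip: of_nat_mult)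
  finally have PN: "P \<le> int N" by simp
  obtain a b where ab: "\<not> (P dvd a \<and> P dvd b)"
    "\<And>n. n \<in> {0..<int N} \<Longrightarrow> padic_val p (a * n + b) \<le> 1 \<Longrightarrow>
       F (n, (\<sigma> + j) * n + (\<tau> + i0)) = last_digit p (a * n + b)"
    using sudoku_line[OF sol, of "\<sigma> + j" "\<tau> + i0"] unfolding P_def by metis
  \<comment> \<open>The board form restricted to this line. Its slope is \<open>B * j\<close> modulo
    \<open>P\<close>, hence nonzero, so \<open>affine_unique\<close> on the first \<open>P\<close>
    columns identifies it with the line's own form.\<close>
  define c d where "c = A + B * (\<sigma> + j)" and "d = B * (\<tau> + i0) + C"
  have c: "P dvd c - B * j" using st(1) by (simp add: c_def algebra_simps)
  have "P dvd d - B * i0" using st(2) by (simp add: d_def algebra_simps)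
  moreover have "\<not> P dvd B * j" using P(1) B j prime_dvd_mult_iff by blast
  ultimately have cd: "\<not> (P dvd c \<and> P dvd d)" using c dvd_iff_if_dvd_diff by blast
  have "P dvd a - c" "P dvd b - d"
  proof -
    have 1: "F (n, (\<sigma> + j) * n + (\<tau> + i0)) = (a * n + b) mod P"
      if "n \<in> {0..<P}" "\<not> P dvd a * n + b" for n
      using ab(2)[of n] that PN
      by (auto simp: P_def last_digit_not_dvd padic_val_not_dvd)
    have 2: "F (n, (\<sigma> + j) * n + (\<tau> + i0)) = (c * n + d) mod P"
      if "n \<in> {0..<P}" "\<not> P dvd c * n + d" for n
    proof -
      have "A * n + B * ((\<sigma> + j) * n + (\<tau> + i0)) + C = c * n + d"
        by (simp add: c_def d_def algebra_simps)
      then show ?thesis using agr[of n "(\<sigma> + j) * n + (\<tau> + i0)"] that PN by simp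
    qed
    show "P dvd a - c" "P dvd b - d"
      using affine_unique[OF P(1) _ _ ab(1) cd 1 2, of "{0..<P}" 0] P(2) by simp_all
  qed
  then have a: "P dvd a - B * j" and "P dvd b - B * i0"
    using c \<open>P dvd d - B * i0\<close> dvd_add[of P "a - c" "c - B * j"] dvd_add[of P "b - d" "d - B * i0"]
    by simp_all
  then have "P dvd (a - B * j) * n0 + (b - B * i0) + P * (B * i)" by simp
  then have "P dvd a * n0 + b" by (simp add: i0_def algebra_simps)
  then obtain b' where b': "a * n0 + b = P * b'" by (auto simp: dvd_def)
  show thesis
  proof
    fix k assume n: "n0 + P * k \<in> {0..<int N}" and nz: "\<not> P dvd B * j * k + b'"
    have *: "P dvd (a * k + b') - (B * j * k + b')"
      using a by (metis add_diff_cancel_right dvd_mult2 left_diff_distrib)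
    then have "\<not> P dvd a * k + b'" using nz dvd_iff_if_dvd_diff by blast
    moreover have "a * (n0 + P * k) + b = P * (a * k + b')" using b' by (simp add: algebra_simps)
    ultimately have "F (n0 + P * k, (\<sigma> + j) * (n0 + P * k) + (\<tau> + i0)) = (a * k + b') mod P"
      using ab(2)[OF n] p(1)
      by (simp add: P_def padic_val_mult last_digit_mult padic_val_not_dvd last_digit_not_dvd one_eSuc)
    moreover have "(\<sigma> + j) * (n0 + P * k) + (\<tau> + i0) = \<sigma> * (n0 + P * k) + \<tau> + P * (j * k + i)"
      by (simp add: i0_def algebra_simps)
    ultimately have "F (n0 + P * k, \<sigma> * (n0 + P * k) + \<tau> + P * (j * k + i)) = (a * k + b') mod P"
      by metis
    then show "F (n0 + P * k, \<sigma> * (n0 + P * k) + \<tau> + P * (j * k + i)) = (B * j * k + b') mod P"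
      using * by (simp add: mod_eq_dvd_iff)
  qed
qed

text \<open>A column with constant value \<open>c\<close> would restrict a single cell
  \<open>v\<close> of the column at distance \<open>P\<close> in contradictory ways, because lines
  of different slopes join that cell to the constant column.\<close>

lemma sublattice_nonconstant:
  fixes p N :: nat
  defines "P \<equiv> int p"
  assumes p: "prime p" "p > 48" "p\<^sup>2 \<le> N" and sol: "sudoku_solution p N F"
    and agr: "\<And>n m. n \<in> {0..<int N} \<Longrightarrow> \<not> P dvd A * n + B * m + C \<Longrightarrow>
      F (n, m) = (A * n + B * m + C) mod P"
    and B: "\<not> P dvd B" and st: "P dvd A + B * \<sigma>" "P dvd C + B * \<tau>"
  shows "nonconstant_columns N (\<lambda>(n, m). F (n, \<sigma> * n + \<tau> + P * m))"
proof -
  have P: "prime P" "P \<ge> 49" using p by (auto simp: P_def)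
  have "P * 2 \<le> P * P" by (rule mult_left_mono) (use P in auto)
  also have "P * P \<le> int N" using p(3) by (simp add: P_def power2_eq_square flip: of_nat_mult)
  finally have PN: "P * 2 \<le> int N" .
  define H where "H n m = F (n, \<sigma> * n + \<tau> + P * m)" for n m
  have "\<exists>m m'. H n m \<noteq> H n m'" if n: "n \<in> {0..<int N}" for n
  proof (rule ccontr)
    assume "\<not> (\<exists>m m'. H n m \<noteq> H n m')"
    then have const: "H n m = H n 0" for m by blast
    define c where "c = H n 0"
    have "c \<in> residue_units p" using sudoku_values[OF sol n] by (simp only: c_def H_def)
    then have c: "\<not> P dvd c" "c mod P = c"
      using residue_units_not_dvd[of c p] by (simp_all add: P_def residue_units_def residue_ring_def)
    define n0 k where "n0 = n mod P" and "k = n div P"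
    have n0: "n0 \<in> {0..<P}" "n = n0 + P * k" using P by (auto simp: n0_def k_def)
    \<comment> \<open>Since \<open>P * 2 \<le> int N\<close>, one of the columns
      \<open>n + P\<close> and \<open>n - P\<close> lies on the board.\<close>
    define s :: int where "s = (if n + P < int N then 1 else - 1)"
    have s: "s = 1 \<or> s = - 1" "n0 + P * (k + s) \<in> {0..<int N}"
      using n n0(2) P(2) PN by (auto simp: s_def algebra_simps)
    define v where "v = H (n0 + P * (k + s)) 0"
    \<comment> \<open>Use the line whose slope \<open>j\<close> satisfies \<open>B j s \<equiv> t c\<close>: in column \<open>n\<close> it takes the value
      \<open>c\<close> or vanishes.\<close>
    have key: "P dvd v - t * c \<or> P dvd v - (t + 1) * c"
      if t: "\<not> P dvd t" "\<not> P dvd t + 1" for t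
    proof -
      obtain e where e: "P dvd B * e - 1" using prime_inverse_mod[OF P(1) B] .
      define j where "j = e * s * t * c"
      have "B * j * s - t * c = (B * e - 1) * (t * c)" using s(1) by (auto simp: j_def algebra_simps)
      then have js: "P dvd B * j * s - t * c" using e by simp
      have "\<not> P dvd t * c" using P(1) t c prime_dvd_mult_iff by blast
      then have "\<not> P dvd B * j * s" using js dvd_iff_if_dvd_diff by blast
      then have j: "\<not> P dvd j" by auto
      obtain b where b: "\<And>k'. n0 + P * k' \<in> {0..<int N} \<Longrightarrow> \<not> P dvd B * j * k' + b \<Longrightarrow>
          F (n0 + P * k', \<sigma> * (n0 + P * k') + \<tau> + P * (j * k' + - j * (k + s)))
            = (B * j * k' + b) mod P"
        by (rule sublattice_lines[OF p sol, of A B C \<sigma> \<tau> n0 j "- j * (k + s)",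
              folded P_def, OF agr B st n0(1) j]) (assumption | rule that)+
      note b = b[folded H_def]
      define y where "y = B * j * k + b"
      have y: "P dvd y \<or> P dvd y - c"
      proof (cases "P dvd y")
        case False
        then have "c = y mod P"
          using b[of k] n n0(2) const[of "j * k + - j * (k + s)"] unfolding y_def c_def by metis
        then have "y mod P = c mod P" using c(2) by simp
        then show ?thesis by (simp add: mod_eq_dvd_iff)
      qed simp
      define z where "z = B * j * (k + s) + b"
      have z: "z = y + B * j * s" by (simp add: z_def y_def algebra_simps)
      have "P dvd z - t * c \<or> P dvd z - (t + 1) * c"
        using y
      proof
        assume "P dvd y"
        then have "P dvd y + (B * j * s - t * c)" using js by simp
        then show ?thesis by (simp add: z algebra_simps)
      next
        assume "P dvd y - c"
        then have "P dvd (y - c) + (B * j * s - t * c)" using js by simp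
        then show ?thesis by (simp add: z algebra_simps)
      qed
      moreover have "\<not> P dvd (t + 1) * c" using P(1) t c prime_dvd_mult_iff by blast
      ultimately have "\<not> P dvd z" using \<open>\<not> P dvd t * c\<close> dvd_iff_if_dvd_diff by blast
      then have "v mod P = z mod P" using b[OF s(2)] by (simp add: v_def z_def)
      then have "P dvd v - z" by (simp add: mod_eq_dvd_iff)
      then have "P dvd v - x \<longleftrightarrow> P dvd z - x" for x
        using dvd_iff_if_dvd_diff[of P "v - x" "z - x"] by simp
      then show ?thesis using \<open>P dvd z - t * c \<or> P dvd z - (t + 1) * c\<close> by simp
    qed
    have small: "\<not> P dvd x" if "x \<in> {1, 2, 3, 4::int}" for x
      using that P(2) zdvd_not_zless[of x P] by auto
    have sep: "\<not> (P dvd v - x * c \<and> P dvd v - y * c)" if "x - y \<in> {1, 2, 3}" for x y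
    proof
      assume "P dvd v - x * c \<and> P dvd v - y * c"
      then have "P dvd (v - y * c) - (v - x * c)" using dvd_diff by blast
      then have "P dvd (x - y) * c" by (simp add: algebra_simps)
      then show False using P(1) small[of "x - y"] c that prime_dvd_mult_iff by blast
    qed
    \<comment> \<open>Taking \<open>t = 1\<close> and \<open>t = 3\<close> confines \<open>v\<close>
      to the disjoint sets \<open>{c, 2c}\<close> and \<open>{3c, 4c}\<close> modulo
      \<open>P\<close>.\<close>
    have "P dvd v - 1 * c \<or> P dvd v - 2 * c" using key[of 1] small[of 1] small[of 2] by simp
    moreover have "P dvd v - 3 * c \<or> P dvd v - 4 * c" using key[of 3] small[of 3] small[of 4] by simp
    moreover have "\<not> (P dvd v - 3 * c \<and> P dvd v - 1 * c)" by (rule sep) simp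
    moreover have "\<not> (P dvd v - 4 * c \<and> P dvd v - 1 * c)" by (rule sep) simp
    moreover have "\<not> (P dvd v - 3 * c \<and> P dvd v - 2 * c)" by (rule sep) simp
    moreover have "\<not> (P dvd v - 4 * c \<and> P dvd v - 2 * c)" by (rule sep) simp
    ultimately show False by blast
  qed
  then show ?thesis by (simp add: nonconstant_columns_def H_def)
qed

text \<open>A line of slope \<open>j\<close> in the new coordinates is a line of slope
  \<open>\<sigma> + int p * j\<close> in the old ones.\<close>

lemma sublattice_solution:
  fixes p N :: nat
  assumes "sudoku_solution p N F"
  shows "sudoku_solution p N (\<lambda>(n, m). F (n, \<sigma> * n + \<tau> + int p * m))"
proof -
  have "(\<lambda>n. F (n, \<sigma> * n + \<tau> + int p * (j * n + i))) \<in> sudoku_rule p N" for j i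
  proof -
    have "\<sigma> * n + \<tau> + int p * (j * n + i) = (\<sigma> + int p * j) * n + (\<tau> + int p * i)" for n
      by (simp add: algebra_simps)
    then show ?thesis using assms unfolding sudoku_solution_def by presburger
  qed
  moreover have "(\<lambda>(n, m). F (n, \<sigma> * n + \<tau> + int p * m)) \<in> board N \<rightarrow> residue_units p"
    using sudoku_values[OF assms] by (auto simp: board_def)
  ultimately show ?thesis by (simp add: sudoku_solution_def)
qed

section \<open>Induction on the valuation bound\<close>

lemma sudoku_affine_upto:
  fixes p N :: nat
  assumes p: "prime p" "p > 48" "p\<^sup>2 \<le> N"
    and "sudoku_solution p N F" "nonconstant_columns N F"
  shows "\<exists>A B C. \<not> int p dvd B \<and> (\<forall>n m. n \<in> {0..<int N} \<longrightarrow>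
           padic_val p (A * n + B * m + C) \<le> enat r \<longrightarrow> F (n, m) = last_digit p (A * n + B * m + C))"
  using assms(4,5)
proof (induction r arbitrary: F)
  case (0 F)
  interpret affine_lines "int p" "int N" F by (rule sudoku_affine_lines[OF p 0(1)])
  obtain A B C where ABC: "\<not> int p dvd B" "\<And>n m. n \<in> {0..<int N} \<Longrightarrow> agrees A B C n m"
    using nonconstant_imp_slope 0(2) unfolding nonconstant_columns_def by metis
  have "\<not> int p dvd x" if "padic_val p x \<le> enat 0" for x
    using padic_val_mult[OF p(1)] that by (auto simp: dvd_def eSuc_def split: enat.splits)
  then show ?case using ABC unfolding agrees_def by (metis last_digit_not_dvd)
next
  case (Suc r F)
  let ?P = "int p"
  have P: "prime ?P" "?P \<ge> 49" using p by auto
  interpret affine_lines ?P "int N" F by (rule sudoku_affine_lines[OF p Suc.prems(1)])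
  obtain A B C where ABC: "\<not> ?P dvd B" "\<And>n m. n \<in> {0..<int N} \<Longrightarrow> agrees A B C n m"
    using nonconstant_imp_slope Suc.prems(2) unfolding nonconstant_columns_def by metis
  then have agr: "F (n, m) = (A * n + B * m + C) mod ?P"
    if "n \<in> {0..<int N}" "\<not> ?P dvd A * n + B * m + C" for n m
    using that unfolding agrees_def by blast
  \<comment> \<open>With \<open>e\<close> inverse to \<open>B\<close>, the form is congruent to
    \<open>B * (m - \<sigma> * n - \<tau>)\<close>, so its zeros modulo \<open>?P\<close> are the
    points parametrized by \<open>F'\<close>.\<close>
  obtain e where e: "?P dvd B * e - 1" using prime_inverse_mod[OF P(1) ABC(1)] .
  define \<sigma> \<tau> where "\<sigma> = - e * A" and "\<tau> = - e * C"
  have "A + B * \<sigma> = - A * (B * e - 1)" "C + B * \<tau> = - C * (B * e - 1)"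
    by (simp_all add: \<sigma>_def \<tau>_def algebra_simps)
  then have st: "?P dvd A + B * \<sigma>" "?P dvd C + B * \<tau>" using e by (metis dvd_mult)+
  define F' where "F' = (\<lambda>(n, m). F (n, \<sigma> * n + \<tau> + ?P * m))"
  have "sudoku_solution p N F'" unfolding F'_def by (rule sublattice_solution[OF Suc.prems(1)])
  moreover have "nonconstant_columns N F'"
    unfolding F'_def by (rule sublattice_nonconstant[OF p Suc.prems(1) agr ABC(1) st])
  ultimately obtain A' B' C' where A': "\<not> ?P dvd B'"
    "\<And>n m. n \<in> {0..<int N} \<Longrightarrow> padic_val p (A' * n + B' * m + C') \<le> enat r \<Longrightarrow>
       F' (n, m) = last_digit p (A' * n + B' * m + C')"
    using Suc.IH by metis
  \<comment> \<open>Compare two descriptions of \<open>F'\<close> at the points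
    \<open>(?P * k, k)\<close>: \<open>sublattice_lines\<close> gives slope \<open>B\<close> in
    \<open>k\<close>, while the form found by induction gives slope \<open>B'\<close>, its
    \<open>A'\<close> term being divisible by \<open>?P\<close>.\<close>
  have BB: "?P dvd B' - B"
  proof -
    have "\<not> ?P dvd 1" using P by (metis not_prime_unit)
    then obtain b where b: "\<And>k. ?P * k \<in> {0..<int N} \<Longrightarrow> \<not> ?P dvd B * k + b \<Longrightarrow>
        F' (?P * k, k) = (B * k + b) mod ?P"
      using sublattice_lines[OF p Suc.prems(1) agr ABC(1) st, of 0 1 0] P(2)
      unfolding F'_def by auto
    have kN: "?P * k \<in> {0..<int N}" if "k \<in> {0..<?P}" for k
    proof -
      have "?P * k < ?P * ?P" by (rule mult_strict_left_mono) (use that P in auto)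
      also have "?P * ?P \<le> int N" using p(3) by (simp add: power2_eq_square flip: of_nat_mult)
      finally show ?thesis using that by simp
    qed
    have "F' (?P * k, k) = (B' * k + C') mod ?P" if "k \<in> {0..<?P}" "\<not> ?P dvd B' * k + C'" for k
    proof -
      have *: "?P dvd (A' * (?P * k) + B' * k + C') - (B' * k + C')" by simp
      then have nd: "\<not> ?P dvd A' * (?P * k) + B' * k + C'"
        using that(2) dvd_iff_if_dvd_diff by blast
      then have "F' (?P * k, k) = (A' * (?P * k) + B' * k + C') mod ?P"
        using A'(2)[OF kN[OF that(1)], of k] by (simp add: padic_val_not_dvd last_digit_not_dvd)
      then show ?thesis using * by (simp add: mod_eq_dvd_iff)
    qed
    then show ?thesis
      using affine_unique(1)[of ?P "{0..<?P}" 0 B' C' B b "\<lambda>k. F' (?P * k, k)"] b[OF kN] P A'(1) ABC(1)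
      by simp
  qed
  \<comment> \<open>The glued form. At \<open>m = \<sigma> * n + \<tau> + ?P * m'\<close> it is
    \<open>?P\<close> times the form of \<open>F'\<close>, so the valuation drops by one. Elsewhere
    it is congruent to \<open>B' * (m - \<sigma> * n - \<tau>)\<close>, hence to the form of
    \<open>F\<close> because \<open>B'\<close> and \<open>B\<close> are congruent.\<close>
  define A'' C'' where "A'' = ?P * A' - B' * \<sigma>" and "C'' = ?P * C' - B' * \<tau>"
  have "F (n, m) = last_digit p (A'' * n + B' * m + C'')"
    if n: "n \<in> {0..<int N}" and val: "padic_val p (A'' * n + B' * m + C'') \<le> enat (Suc r)" for n m
  proof (cases "?P dvd m - (\<sigma> * n + \<tau>)")
    case True
    then obtain m' where "m - (\<sigma> * n + \<tau>) = ?P * m'" by (auto simp: dvd_def)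
    then have m': "m = \<sigma> * n + \<tau> + ?P * m'" by simp
    define y where "y = A' * n + B' * m' + C'"
    have y: "A'' * n + B' * m + C'' = ?P * y"
      by (simp add: y_def A''_def C''_def m' algebra_simps)
    have "padic_val p y \<le> enat r" using val unfolding y padic_val_mult[OF p(1)]
      by (simp flip: eSuc_enat)
    then show ?thesis unfolding y last_digit_mult[OF p(1)]
      using A'(2)[OF n, of m'] by (simp add: y_def F'_def m')
  next
    case False
    define x where "x = A'' * n + B' * m + C''"
    have "x - B' * (m - (\<sigma> * n + \<tau>)) = ?P * (A' * n + C')"
      by (simp add: x_def A''_def C''_def algebra_simps)
    moreover have "\<not> ?P dvd B' * (m - (\<sigma> * n + \<tau>))"
      using P(1) A'(1) False prime_dvd_mult_iff by blast
    ultimately have x: "\<not> ?P dvd x" by (metis dvd_iff_if_dvd_diff dvd_triv_left)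
    have "x - (A * n + B * m + C) = ?P * (A' * n + C') + (B' - B) * (m - (\<sigma> * n + \<tau>))
        - (A + B * \<sigma>) * n - (C + B * \<tau>)"
      by (simp add: x_def A''_def C''_def algebra_simps)
    then have *: "?P dvd x - (A * n + B * m + C)"
      using BB st by (metis dvd_add dvd_diff dvd_mult2 dvd_triv_left)
    then have "\<not> ?P dvd A * n + B * m + C" using x dvd_iff_if_dvd_diff by blast
    moreover have "x mod ?P = (A * n + B * m + C) mod ?P" using * by (simp add: mod_eq_dvd_iff)
    ultimately have "F (n, m) = x mod ?P" using agr[OF n] by simp
    then show ?thesis using x by (simp add: last_digit_not_dvd x_def)
  qed
  then show ?case using A'(1) by blast
qed

theorem theorem4p9:
  fixes p N :: nat and F :: "int \<times> int \<Rightarrow> int"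
  assumes "prime p" and "p > 48"
    and "p^2 dvd N"
    and "sudoku_solution p N F"
    and "nonconstant_columns N F"
  shows "\<forall>r::nat. \<exists>A B C :: int. \<not> int p dvd B \<and>
           (\<forall>(n, m)\<in>board N. padic_val p (A * n + B * m + C) \<le> enat r \<longrightarrow>
              F (n, m) = last_digit p (A * n + B * m + C))"
proof
  fix r
  show "\<exists>A B C :: int. \<not> int p dvd B \<and>
           (\<forall>(n, m)\<in>board N. padic_val p (A * n + B * m + C) \<le> enat r \<longrightarrow>
              F (n, m) = last_digit p (A * n + B * m + C))"
  \<comment> \<open>Zero is a multiple of \<open>p^2\<close> too; the board is then empty and any
    \<open>B\<close> prime to \<open>p\<close> serves.\<close>
  proof (cases "N = 0")
    case True
    have "\<not> int p dvd 1" using assms(2) by auto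
    then show ?thesis using True by (intro exI[of _ 0] exI[of _ 1]) (simp add: board_def)
  next
    case False
    then have "p\<^sup>2 \<le> N" using assms(3) by (intro dvd_imp_le) auto
    from sudoku_affine_upto[OF assms(1,2) this assms(4,5), of r]
    show ?thesis unfolding board_def by fast
  qed
qed

end
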